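(* Let $\mathcal{A}$ be a commutative, associative, unital, finite-dimensional real algebra and let $L\in\mathcal{A}[D]$. Consider the constant coefficient $\mathcal{A}$-ODE $L[w]=0$. There exists a fixed nonzero constant $c\in\mathcal{A}$ such that $w=c\,f(z)$ is a solution of $L[w]=0$ for every function $f\in C(\mathcal{A})$ if and only if $L\in\mathbf{zd}(\mathcal{A}[D])$.
   Context: For $U\subseteq\mathcal{A}$ open, $f:U\to\mathcal{A}$ is $\mathcal{A}$-differentiable at $p$ if there is a real-linear map $d_pf:\mathcal{A}\to\mathcal{A}$ with $d_pf(xy)=d_pf(x)y$ for all $x,y\in\mathcal{A}$ and $\lim_{h\to0}\frac{f(p+h)-f(p)-d_pf(h)}{\|h\|}=0$ (any norm); then $f'(p)=d_pf(1)$, and higher derivatives are defined by iteration. $C(\mathcal{A})$ denotes the functions $\mathcal{A}\to\mathcal{A}$ that are $\mathcal{A}$-differentiable to all orders. $D=d/dz$ is $\mathcal{A}$-differentiation, and $\mathcal{A}[D]$ is the commutative ring (under composition) of operators $a_nD^n+\cdots+a_1D+a_0$ with $a_i\in\mathcal{A}$, isomorphic to the polynomial ring $\mathcal{A}[x]$ via $x\mapsto D$. For a commutative ring $R$, $\mathbf{zd}(R)=\{r\in R: r=0\text{ or } r\text{ is a zero-divisor}\}$. *)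

theory Defs
  imports Complex_Main "HOL-Algebra.Ring"
begin

text \<open>
  The algebra is a type of sort \<open>{real_normed_vector, real_algebra_1, comm_ring_1}\<close>. The norm is
  an arbitrary vector space norm: it is not assumed to be submultiplicative.
\<close>

text \<open>
  The Frechet derivative of the library is a bounded linear map. In a finite-dimensional algebra,
  boundedness holds for every real-linear map.
\<close>

definition has_alg_differential ::
  "('a :: {real_normed_vector, real_algebra_1, comm_ring_1} \<Rightarrow> 'a) \<Rightarrow> ('a \<Rightarrow> 'a) \<Rightarrow> 'a \<Rightarrow> bool"
  where
  "has_alg_differential f T p \<longleftrightarrow>
     (f has_derivative T) (at p) \<and> (\<forall>x y. T (x * y) = T x * y)"

definition alg_differentiable ::
  "('a :: {real_normed_vector, real_algebra_1, comm_ring_1} \<Rightarrow> 'a) \<Rightarrow> 'a \<Rightarrow> bool"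
  where
  "alg_differentiable f p \<longleftrightarrow> (\<exists>T. has_alg_differential f T p)"

definition alg_deriv ::
  "('a :: {real_normed_vector, real_algebra_1, comm_ring_1} \<Rightarrow> 'a) \<Rightarrow> 'a \<Rightarrow> 'a"
  where
  "alg_deriv f p = (THE T. has_alg_differential f T p) 1"

definition alg_smooth ::
  "('a :: {real_normed_vector, real_algebra_1, comm_ring_1} \<Rightarrow> 'a) set"
  where
  "alg_smooth = {f. \<forall>n p. alg_differentiable ((alg_deriv ^^ n) f) p}"

text \<open>
  Operators act on \<open>alg_smooth\<close>; \<open>restrict\<close> gives them a fixed default value elsewhere, so that
  HOL equality of operators is equality on \<open>alg_smooth\<close>.
\<close>

definition diff_op ::
  "nat \<Rightarrow> (nat \<Rightarrow> 'a) \<Rightarrow> ('a :: {real_normed_vector, real_algebra_1, comm_ring_1} \<Rightarrow> 'a) \<Rightarrow> ('a \<Rightarrow> 'a)"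
  where
  "diff_op n a = (\<lambda>w\<in>alg_smooth. \<lambda>z. \<Sum>i\<le>n. a i * (alg_deriv ^^ i) w z)"

definition diff_op_ring ::
  "(('a :: {real_normed_vector, real_algebra_1, comm_ring_1} \<Rightarrow> 'a) \<Rightarrow> ('a \<Rightarrow> 'a)) ring"
  where
  "diff_op_ring =
     \<lparr>carrier = {L. \<exists>n a. L = diff_op n a},
      mult = compose alg_smooth,
      one = (\<lambda>w\<in>alg_smooth. w),
      zero = (\<lambda>w\<in>alg_smooth. \<lambda>z. 0),
      add = (\<lambda>P Q. \<lambda>w\<in>alg_smooth. \<lambda>z. P w z + Q w z)\<rparr>"

definition zd :: "('r, 'm) ring_scheme \<Rightarrow> 'r set"
  where
  "zd R = {r \<in> carrier R. r = \<zero>\<^bsub>R\<^esub> \<or>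
             (\<exists>s \<in> carrier R. s \<noteq> \<zero>\<^bsub>R\<^esub> \<and> r \<otimes>\<^bsub>R\<^esub> s = \<zero>\<^bsub>R\<^esub>)}"

definition ode_solution ::
  "(('a :: {real_normed_vector, real_algebra_1, comm_ring_1} \<Rightarrow> 'a) \<Rightarrow> ('a \<Rightarrow> 'a)) \<Rightarrow> ('a \<Rightarrow> 'a) \<Rightarrow> bool"
  where
  "ode_solution L w \<longleftrightarrow> w \<in> alg_smooth \<and> L w = (\<lambda>z. 0)"

end

theory Submission
  imports Defs "HOL-Computational_Algebra.Polynomial"
begin

text \<open>
  Evaluating \<open>L \<circ> S\<close> on \<open>z ^ k / k!\<close> at \<open>z = 0\<close> returns the \<open>k\<close>-th coefficient of the product of the
  symbols of \<open>L\<close> and \<open>S\<close>. Hence \<open>L \<circ> S = 0\<close> says that the product of the symbols vanishes, and by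
  McCoy's theorem a zero divisor of \<open>\<A>[x]\<close> is annihilated by a nonzero constant \<open>c\<close>; since \<open>c\<close>
  commutes with \<open>D\<close>, it follows that \<open>L[c f] = 0\<close>. Conversely, if \<open>L[c f] = 0\<close> for all \<open>f\<close>, then
  \<open>L\<close> is annihilated by the operator \<open>c\<close> of order zero. The powers of \<open>z\<close> are differentiable
  because a multiplication on a finite-dimensional space is bounded for every norm.
\<close>

section \<open>Boundedness of multiplication for an arbitrary norm\<close>

text \<open>Induction on \<open>B\<close>: the bound on coordinates makes the span of
  \<open>B\<close> closed, so a vector \<open>v\<close> outside it lies at positive distance, and
  this distance controls the coordinate along \<open>v\<close>.\<close>

lemma coordinates_bounded:
  fixes B :: "'v::real_normed_vector set"
  assumes "finite B" "independent B"
  shows "\<exists>K\<ge>0. \<forall>u. \<forall>b\<in>B. \<bar>u b\<bar> \<le> K * norm (\<Sum>b\<in>B. u b *\<^sub>R b)"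
  using assms
proof (induction B)
  case empty
  then show ?case by auto
next
  case (insert v B)
  from insert.prems insert.hyps have indB: "independent B" and v: "v \<notin> span B"
    by (simp_all add: independent_insert)
  obtain K where K0: "K \<ge> 0" and
    K: "\<And>u b. b \<in> B \<Longrightarrow> \<bar>u b\<bar> \<le> K * norm (\<Sum>b\<in>B. u b *\<^sub>R b)"
    using insert.IH[OF indB] by blast
  \<comment> \<open>Otherwise a sequence in the span of \<open>B\<close> converges to
    \<open>v\<close>. Its coordinates are Cauchy by the induction hypothesis, and their limits
    express \<open>v\<close> in terms of \<open>B\<close>.\<close>
  have "\<exists>d>0. \<forall>u. d \<le> norm (v - (\<Sum>b\<in>B. u b *\<^sub>R b))"
  proof (rule ccontr)
    assume "\<not> ?thesis"
    then have "\<forall>n. \<exists>u. norm (v - (\<Sum>b\<in>B. u b *\<^sub>R b)) < inverse (real (Suc n))"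
      by (metis inverse_positive_iff_positive not_le of_nat_0_less_iff zero_less_Suc)
    then obtain u where u: "\<And>n. norm (v - (\<Sum>b\<in>B. u n b *\<^sub>R b)) < inverse (real (Suc n))"
      by metis
    define s where "s n = (\<Sum>b\<in>B. u n b *\<^sub>R b)" for n
    have "(\<lambda>n. v - s n) \<longlonglongrightarrow> 0"
    proof (rule tendsto_norm_zero_cancel)
      have "\<forall>\<^sub>F n in sequentially. norm (v - s n) \<le> inverse (real (Suc n))"
        using u by (intro always_eventually allI) (simp add: s_def less_imp_le del: of_nat_Suc)
      then show "(\<lambda>n. norm (v - s n)) \<longlonglongrightarrow> 0"
        by (rule tendsto_sandwich[OF _ _ tendsto_const LIMSEQ_inverse_real_of_nat, rotated]) simp
    qed
    from tendsto_diff[OF tendsto_const[of v] this] have sv: "s \<longlonglongrightarrow> v"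
      by simp
    then have cs: "Cauchy s"
      by (rule LIMSEQ_imp_Cauchy)
    have "convergent (\<lambda>n. u n b)" if b: "b \<in> B" for b
    proof -
      have "Cauchy (\<lambda>n. u n b)"
      proof (rule CauchyI)
        fix e :: real
        assume "e > 0"
        \<comment> \<open>\<open>K\<close> is only known to be nonnegative, so \<open>K + 1\<close>
          serves as the divisor.\<close>
        with K0 have "e / (K + 1) > 0"
          by simp
        from CauchyD[OF cs this] obtain M where
          M: "\<And>m n. m \<ge> M \<Longrightarrow> n \<ge> M \<Longrightarrow> norm (s m - s n) < e / (K + 1)"
          by blast
        have "norm (u m b - u n b) < e" if "m \<ge> M" "n \<ge> M" for m n
        proof -
          have "\<bar>u m b - u n b\<bar> \<le> K * norm (s m - s n)"
            using K[OF b, of "\<lambda>b. u m b - u n b"]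
            by (simp add: s_def scaleR_diff_left sum_subtractf)
          also have "\<dots> \<le> (K + 1) * norm (s m - s n)"
            by (simp add: mult_right_mono)
          also have "\<dots> < e"
            using M[OF that] K0 by (simp add: field_simps)
          finally show ?thesis
            by simp
        qed
        then show "\<exists>M. \<forall>m\<ge>M. \<forall>n\<ge>M. norm (u m b - u n b) < e"
          by blast
      qed
      then show ?thesis
        by (rule Cauchy_convergent)
    qed
    then have "\<forall>b\<in>B. \<exists>l. (\<lambda>n. u n b) \<longlonglongrightarrow> l"
      by (simp add: convergent_def)
    then obtain l where l: "\<And>b. b \<in> B \<Longrightarrow> (\<lambda>n. u n b) \<longlonglongrightarrow> l b"
      by metis
    have "s \<longlonglongrightarrow> (\<Sum>b\<in>B. l b *\<^sub>R b)"
      unfolding s_def using l by (intro tendsto_intros)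
    with sv have "v = (\<Sum>b\<in>B. l b *\<^sub>R b)"
      by (rule LIMSEQ_unique)
    also have "\<dots> \<in> span B"
      by (simp add: span_base span_scale span_sum)
    finally show False
      using v by simp
  qed
  then obtain d where d0: "d > 0" and d: "\<And>u. d \<le> norm (v - (\<Sum>b\<in>B. u b *\<^sub>R b))"
    by blast
  \<comment> \<open>With \<open>x = u v *\<^sub>R v + y\<close>, the first summand bounds the
    coordinate along \<open>v\<close>. The second bounds the others, through the estimate for the
    norm of \<open>y\<close> in terms of that of \<open>x\<close>.\<close>
  define K' where "K' = 1 / d + K * (1 + norm v / d)"
  have "\<bar>u b\<bar> \<le> K' * norm (\<Sum>b\<in>insert v B. u b *\<^sub>R b)" if b: "b \<in> insert v B" for u b
  proof -
    define y where "y = (\<Sum>b\<in>B. u b *\<^sub>R b)"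
    define x where "x = (\<Sum>b\<in>insert v B. u b *\<^sub>R b)"
    have x: "x = u v *\<^sub>R v + y"
      using insert.hyps by (simp add: x_def y_def)
    have uv: "\<bar>u v\<bar> \<le> norm x / d"
    proof (cases "u v = 0")
      case True
      then show ?thesis using d0 by simp
    next
      case False
      \<comment> \<open>Dividing \<open>x\<close> by \<open>u v\<close> gives \<open>v\<close> minus
        an element of the span of \<open>B\<close>, so the quotient has norm at least
        \<open>d\<close>.\<close>
      have "(\<Sum>b\<in>B. (- u b / u v) *\<^sub>R b) = - ((1 / u v) *\<^sub>R y)"
        by (simp add: y_def scaleR_sum_right sum_negf[symmetric])
      with d[of "\<lambda>b. - u b / u v"] have "d \<le> norm (v + (1 / u v) *\<^sub>R y)"
        by simp
      also have "v + (1 / u v) *\<^sub>R y = (1 / u v) *\<^sub>R x"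
        using False by (simp add: x scaleR_add_right)
      finally show ?thesis
        using False d0 by (simp add: field_simps)
    qed
    have "norm y \<le> norm x + norm (u v *\<^sub>R v)"
      using norm_triangle_ineq4[of x "u v *\<^sub>R v"] by (simp add: x)
    also have "\<dots> \<le> norm x + norm x / d * norm v"
      using mult_right_mono[OF uv norm_ge_zero[of v]] by simp
    also have "\<dots> = (1 + norm v / d) * norm x"
      by (simp add: algebra_simps)
    finally have y: "norm y \<le> (1 + norm v / d) * norm x" .
    have nn: "0 \<le> norm x / d" "0 \<le> K * ((1 + norm v / d) * norm x)"
      using d0 K0 by simp_all
    have K'x: "K' * norm x = norm x / d + K * ((1 + norm v / d) * norm x)"
      by (simp add: K'_def algebra_simps)
    show ?thesis
    proof (cases "b = v")
      case True
      then show ?thesis using uv nn K'x by (simp add: x_def[symmetric])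
    next
      case False
      with b have "\<bar>u b\<bar> \<le> K * norm y"
        unfolding y_def by (intro K) auto
      also have "\<dots> \<le> K * ((1 + norm v / d) * norm x)"
        using y K0 by (rule mult_left_mono)
      finally show ?thesis using nn K'x by (simp add: x_def[symmetric])
    qed
  qed
  moreover have "K' \<ge> 0"
    using K0 d0 by (simp add: K'_def)
  ultimately show ?case
    by blast
qed

text \<open>Both factors are expanded in a basis. Their coordinates are bounded by the norms, and
  only finitely many products of basis vectors occur; \<open>M\<close> collects the norms of these
  products.\<close>

lemma bounded_bilinear_mult_finite_dim:
  assumes "\<exists>B :: 'a set. finite B \<and> span B = UNIV"
  shows "bounded_bilinear ((*) :: 'a::{real_normed_vector, real_algebra_1} \<Rightarrow> 'a \<Rightarrow> 'a)"
proof -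
  from assms obtain B0 :: "'a set" where B0: "finite B0" "span B0 = UNIV"
    by blast
  obtain B where B: "B \<subseteq> B0" "independent B" "B0 \<subseteq> span B"
    using maximal_independent_subset by blast
  have fin: "finite B"
    using B0 B finite_subset by blast
  have sp: "span B = UNIV"
    using B0 B span_mono[OF B(3)] by (simp add: span_span top.extremum_unique)
  obtain K where K0: "K \<ge> 0" and
    K: "\<And>u b. b \<in> B \<Longrightarrow> \<bar>u b\<bar> \<le> K * norm (\<Sum>b\<in>B. u b *\<^sub>R b)"
    using coordinates_bounded[OF fin B(2)] by blast
  define r where "r x b = representation B x b" for x b
  have r: "(\<Sum>b\<in>B. r x b *\<^sub>R b) = x" for x
    using B(2) sp fin unfolding r_def by (intro sum_representation_eq) auto
  have rK: "\<bar>r x b\<bar> \<le> K * norm x" if "b \<in> B" for x b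
    using K[OF that, of "r x"] by (simp add: r)
  define M where "M = (\<Sum>b\<in>B. \<Sum>b'\<in>B. K * K * norm (b * b'))"
  have "norm (x * y) \<le> norm x * norm y * M" for x y :: 'a
  proof -
    have "x * y = (\<Sum>b\<in>B. r x b *\<^sub>R b) * (\<Sum>b'\<in>B. r y b' *\<^sub>R b')"
      by (simp only: r)
    also have "\<dots> = (\<Sum>b\<in>B. \<Sum>b'\<in>B. (r x b * r y b') *\<^sub>R (b * b'))"
      by (simp add: sum_product mult.commute)
    also have "norm \<dots> \<le> (\<Sum>b\<in>B. \<Sum>b'\<in>B. norm ((r x b * r y b') *\<^sub>R (b * b')))"
      by (rule order_trans[OF norm_sum sum_mono[OF norm_sum]])
    also have "\<dots> \<le> (\<Sum>b\<in>B. \<Sum>b'\<in>B. norm x * norm y * (K * K * norm (b * b')))"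
    proof (intro sum_mono)
      fix b b'
      assume "b \<in> B" "b' \<in> B"
      then have "\<bar>r x b\<bar> * \<bar>r y b'\<bar> \<le> (K * norm x) * (K * norm y)"
        using K0 by (intro mult_mono rK) auto
      from mult_right_mono[OF this norm_ge_zero[of "b * b'"]]
      show "norm ((r x b * r y b') *\<^sub>R (b * b')) \<le> norm x * norm y * (K * K * norm (b * b'))"
        by (simp add: abs_mult mult_ac)
    qed
    also have "\<dots> = norm x * norm y * M"
      by (simp add: M_def sum_distrib_left)
    finally show ?thesis .
  qed
  then show ?thesis
    by unfold_locales (auto simp: algebra_simps)
qed

section \<open>McCoy's theorem\<close>

text \<open>Descent on the degree of the annihilator. If every coefficient of \<open>P\<close> kills
  \<open>Q\<close>, the leading coefficient of \<open>Q\<close> serves as \<open>c\<close>;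
  otherwise a suitable coefficient multiple of \<open>Q\<close> is a nonzero annihilator of smaller
  degree.\<close>

lemma mccoy:
  fixes P Q :: "'a::comm_ring_1 poly"
  assumes "Q \<noteq> 0" "P * Q = 0"
  shows "\<exists>c. c \<noteq> 0 \<and> (\<forall>i. coeff P i * c = 0)"
  using assms
proof (induction "degree Q" arbitrary: Q rule: less_induct)
  case less
  show ?case
  proof (cases "\<forall>i. smult (coeff P i) Q = 0")
    case True
    then have "coeff P i * lead_coeff Q = 0" for i
      by (metis coeff_0 coeff_smult)
    with less.prems show ?thesis
      by (metis leading_coeff_0_iff)
  next
    case False
    let ?S = "{i. smult (coeff P i) Q \<noteq> 0}"
    have "?S \<subseteq> {..degree P}"
      by (auto intro: ccontr simp: coeff_eq_0 not_le)
    then have fin: "finite ?S"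
      using finite_subset by blast
    \<comment> \<open>In the coefficient of \<open>P * Q\<close> at \<open>i + degree Q\<close>, the
      terms above \<open>i\<close> vanish by maximality and those below \<open>i\<close> by degree.
      What remains is \<open>coeff P i\<close> times the leading coefficient of
      \<open>Q\<close>.\<close>
    define i where "i = Max ?S"
    have i: "smult (coeff P i) Q \<noteq> 0"
      using Max_in[OF fin] False by (auto simp: i_def)
    have gt: "smult (coeff P j) Q = 0" if "j > i" for j
      using Max_ge[OF fin, of j] that by (auto simp: i_def)
    let ?m = "degree Q"
    have "0 = coeff (P * Q) (i + ?m)"
      by (simp add: less.prems)
    also have "\<dots> = (\<Sum>j\<le>i + ?m. coeff P j * coeff Q (i + ?m - j))"
      by (rule coeff_mult)
    also have "\<dots> = (\<Sum>j\<in>{i}. coeff P j * coeff Q (i + ?m - j))"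
    proof (intro sum.mono_neutral_right ballI)
      fix j
      assume "j \<in> {..i + ?m} - {i}"
      then consider "j < i" | "j > i"
        by force
      then show "coeff P j * coeff Q (i + ?m - j) = 0"
      proof cases
        case 1
        then show ?thesis by (simp add: coeff_eq_0)
      next
        case 2
        then show ?thesis using gt[OF 2] by (metis coeff_0 coeff_smult)
      qed
    qed auto
    finally have lead: "coeff (smult (coeff P i) Q) ?m = 0"
      by simp
    have "degree (smult (coeff P i) Q) \<noteq> ?m"
      using lead i leading_coeff_0_iff by metis
    then have "degree (smult (coeff P i) Q) < ?m"
      using degree_smult_le le_neq_implies_less by blast
    then show ?thesis
      using i less.hyps[of "smult (coeff P i) Q"] less.prems by simp
  qed
qed

section \<open>Differentiation and multiplication by constants\<close>

lemma alg_deriv_eq: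
  assumes "has_alg_differential f T p"
  shows "alg_deriv f p = T 1"
proof -
  have "(THE T. has_alg_differential f T p) = T"
    using assms unfolding has_alg_differential_def by (blast intro: has_derivative_unique)
  then show ?thesis
    by (simp add: alg_deriv_def)
qed

lemma alg_differentiable_cmult:
  assumes mult: "bounded_bilinear ((*) :: 'a \<Rightarrow> 'a \<Rightarrow> 'a)"
    and f: "alg_differentiable f p"
  shows "alg_differentiable (\<lambda>z. c * f z :: 'a::{real_normed_vector, real_algebra_1, comm_ring_1}) p"
    and "alg_deriv (\<lambda>z. c * f z) p = c * alg_deriv f p"
proof -
  obtain T where T: "has_alg_differential f T p"
    using f by (auto simp: alg_differentiable_def)
  then have "has_alg_differential (\<lambda>z. c * f z) (\<lambda>h. c * T h) p"
    using bounded_linear.has_derivative[OF bounded_bilinear.bounded_linear_right[OF mult]]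
    by (auto simp: has_alg_differential_def mult.assoc)
  then show "alg_differentiable (\<lambda>z. c * f z) p"
    and "alg_deriv (\<lambda>z. c * f z) p = c * alg_deriv f p"
    using alg_deriv_eq[OF T] by (auto simp: alg_differentiable_def dest: alg_deriv_eq)
qed

lemma alg_deriv_funpow_cmult:
  assumes "bounded_bilinear ((*) :: 'a \<Rightarrow> 'a \<Rightarrow> 'a)" and "f \<in> alg_smooth"
  shows "(alg_deriv ^^ n) (\<lambda>z. c * f z) =
    (\<lambda>z. c * (alg_deriv ^^ n) f z :: 'a::{real_normed_vector, real_algebra_1, comm_ring_1})"
proof (induction n)
  case (Suc n)
  then show ?case
    using assms alg_differentiable_cmult(2) by (fastforce simp: alg_smooth_def)
qed simp

lemma alg_smooth_cmult:
  assumes "bounded_bilinear ((*) :: 'a \<Rightarrow> 'a \<Rightarrow> 'a)" and "f \<in> alg_smooth"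
  shows "(\<lambda>z. c * f z :: 'a::{real_normed_vector, real_algebra_1, comm_ring_1}) \<in> alg_smooth"
  using assms(2)
  by (auto simp: alg_smooth_def alg_deriv_funpow_cmult[OF assms] intro!: alg_differentiable_cmult(1)[OF assms(1)])

section \<open>Polynomials in divided powers\<close>

text \<open>Dividing by \<open>k!\<close> makes differentiation a shift of the coefficient sequence.\<close>

definition exp_poly :: "nat \<Rightarrow> (nat \<Rightarrow> 'a) \<Rightarrow> 'a \<Rightarrow> 'a::{real_algebra_1, comm_ring_1}"
  where "exp_poly N c z = (\<Sum>k\<le>N. c k * (z ^ k /\<^sub>R fact k))"

lemma exp_poly_0 [simp]: "exp_poly N c 0 = c 0"
proof -
  have "exp_poly N c 0 = (\<Sum>k\<le>N. if k = 0 then c 0 else 0)"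
    unfolding exp_poly_def by (intro sum.cong) (auto simp: power_0_left)
  then show ?thesis
    by simp
qed

text \<open>The differential is multiplication by an algebra element, which is the form that makes
  it linear over the algebra. The exponent \<open>Suc k\<close> avoids subtraction.\<close>

lemma has_derivative_divided_power:
  assumes mult: "bounded_bilinear ((*) :: 'a \<Rightarrow> 'a \<Rightarrow> 'a::{real_normed_vector, real_algebra_1, comm_ring_1})"
  shows "((\<lambda>z::'a. z ^ Suc k /\<^sub>R fact (Suc k)) has_derivative (\<lambda>h. (p ^ k /\<^sub>R fact k) * h)) (at p)"
proof -
  have "((\<lambda>z. z ^ Suc k) has_derivative (\<lambda>h. real (Suc k) *\<^sub>R (p ^ k * h))) (at p)"
  proof (induction k)
    case 0
    then show ?case by simp
  next
    case (Suc k)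
    have "((\<lambda>z. z * z ^ Suc k) has_derivative
        (\<lambda>h. p * (real (Suc k) *\<^sub>R (p ^ k * h)) + h * p ^ Suc k)) (at p)"
      by (rule bounded_bilinear.FDERIV[OF mult has_derivative_ident Suc])
    also have "(\<lambda>h. p * (real (Suc k) *\<^sub>R (p ^ k * h)) + h * p ^ Suc k) =
        (\<lambda>h. real (Suc (Suc k)) *\<^sub>R (p ^ Suc k * h))"
      unfolding of_nat_Suc[of "Suc k"] scaleR_add_left
      by (simp add: ac_simps del: of_nat_Suc)
    finally show ?case
      by simp
  qed
  from has_derivative_scaleR_right[OF this, of "inverse (fact (Suc k))"]
  have "((\<lambda>z. z ^ Suc k /\<^sub>R fact (Suc k)) has_derivative
      (\<lambda>h. (inverse (fact (Suc k)) * real (Suc k)) *\<^sub>R (p ^ k * h))) (at p)"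
    by (simp only: scaleR_scaleR)
  also have "inverse (fact (Suc k)) * real (Suc k) = inverse (fact k)"
    by (simp add: field_simps del: of_nat_Suc)
  finally show ?thesis
    by simp
qed

text \<open>The bound \<open>N\<close> is kept under differentiation so that the shift can be
  iterated. The top coefficient then becomes \<open>c (Suc N)\<close>, which is why \<open>c\<close>
  has to vanish beyond \<open>N\<close>.\<close>

lemma exp_poly_deriv:
  fixes c :: "nat \<Rightarrow> 'a::{real_normed_vector, real_algebra_1, comm_ring_1}"
  assumes mult: "bounded_bilinear ((*) :: 'a \<Rightarrow> 'a \<Rightarrow> 'a)"
    and c: "\<And>k. k > N \<Longrightarrow> c k = 0"
  shows "alg_differentiable (exp_poly N c) p"
    and "alg_deriv (exp_poly N c) p = exp_poly N (\<lambda>k. c (Suc k)) p"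
proof -
  define T where "T = (\<lambda>h. (\<Sum>k<N. c (Suc k) * ((p ^ k /\<^sub>R fact k) * h)))"
  have E: "exp_poly N c = (\<lambda>z. c 0 + (\<Sum>k<N. c (Suc k) * (z ^ Suc k /\<^sub>R fact (Suc k))))"
    by (simp add: exp_poly_def fun_eq_iff sum.atMost_shift)
  have "((\<lambda>z. c 0 + (\<Sum>k<N. c (Suc k) * (z ^ Suc k /\<^sub>R fact (Suc k)))) has_derivative
      (\<lambda>h. 0 + T h)) (at p)"
    unfolding T_def
    by (intro has_derivative_add has_derivative_const has_derivative_sum
        bounded_linear.has_derivative[OF bounded_bilinear.bounded_linear_right[OF mult]]
        has_derivative_divided_power[OF mult])
  then have T: "has_alg_differential (exp_poly N c) T p"
    by (simp add: has_alg_differential_def E T_def sum_distrib_right mult.assoc)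
  then show "alg_differentiable (exp_poly N c) p"
    by (auto simp: alg_differentiable_def)
  show "alg_deriv (exp_poly N c) p = exp_poly N (\<lambda>k. c (Suc k)) p"
    unfolding alg_deriv_eq[OF T]
    by (simp add: T_def exp_poly_def lessThan_Suc_atMost[symmetric] c)
qed

lemma exp_poly_deriv_funpow:
  fixes c :: "nat \<Rightarrow> 'a::{real_normed_vector, real_algebra_1, comm_ring_1}"
  assumes "bounded_bilinear ((*) :: 'a \<Rightarrow> 'a \<Rightarrow> 'a)" and "\<And>k. k > N \<Longrightarrow> c k = 0"
  shows "(alg_deriv ^^ i) (exp_poly N c) = exp_poly N (\<lambda>k. c (k + i))"
proof (induction i)
  case (Suc i)
  show ?case
    by (rule ext) (simp add: Suc assms exp_poly_deriv(2))
qed simp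

lemma exp_poly_smooth:
  fixes c :: "nat \<Rightarrow> 'a::{real_normed_vector, real_algebra_1, comm_ring_1}"
  assumes "bounded_bilinear ((*) :: 'a \<Rightarrow> 'a \<Rightarrow> 'a)" and "\<And>k. k > N \<Longrightarrow> c k = 0"
  shows "exp_poly N c \<in> alg_smooth"
  using assms by (auto simp: alg_smooth_def exp_poly_deriv_funpow intro!: exp_poly_deriv(1))

text \<open>The image is again an \<open>exp_poly\<close>, so a composition of two operators can be
  computed on coefficient sequences.\<close>

lemma diff_op_exp_poly:
  fixes c :: "nat \<Rightarrow> 'a::{real_normed_vector, real_algebra_1, comm_ring_1}"
  assumes "bounded_bilinear ((*) :: 'a \<Rightarrow> 'a \<Rightarrow> 'a)" and "\<And>k. k > N \<Longrightarrow> c k = 0"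
  shows "diff_op n a (exp_poly N c) = exp_poly N (\<lambda>k. \<Sum>i\<le>n. a i * c (k + i))"
proof
  fix z
  have "diff_op n a (exp_poly N c) z = (\<Sum>i\<le>n. a i * exp_poly N (\<lambda>k. c (k + i)) z)"
    using assms by (simp add: diff_op_def exp_poly_smooth exp_poly_deriv_funpow)
  also have "\<dots> = (\<Sum>i\<le>n. \<Sum>k\<le>N. a i * c (k + i) * (z ^ k /\<^sub>R fact k))"
    by (simp add: exp_poly_def sum_distrib_left mult.assoc)
  also have "\<dots> = (\<Sum>k\<le>N. \<Sum>i\<le>n. a i * c (k + i) * (z ^ k /\<^sub>R fact k))"
    by (rule sum.swap)
  also have "\<dots> = exp_poly N (\<lambda>k. \<Sum>i\<le>n. a i * c (k + i)) z"
    by (simp only: exp_poly_def sum_distrib_right)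
  finally show "diff_op n a (exp_poly N c) z = exp_poly N (\<lambda>k. \<Sum>i\<le>n. a i * c (k + i)) z" .
qed

text \<open>Every iterated derivative of a constant is again constant. The function 1 later shows
  that multiplication by a nonzero \<open>c\<close> is not the zero operator.\<close>

lemma const_smooth: "(\<lambda>z. c) \<in> alg_smooth"
proof -
  have D: "has_alg_differential (\<lambda>z. d) (\<lambda>h. 0) p" for d p :: 'a
    by (simp add: has_alg_differential_def)
  have "\<exists>d. (alg_deriv ^^ n) (\<lambda>z. c) = (\<lambda>z. d)" for n
  proof (induction n)
    case (Suc n)
    then obtain d where "(alg_deriv ^^ n) (\<lambda>z. c) = (\<lambda>z. d)"
      by blast
    then have "(alg_deriv ^^ Suc n) (\<lambda>z. c) = (\<lambda>z. 0)"
      by (simp add: fun_eq_iff[of "alg_deriv _"] alg_deriv_eq[OF D])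
    then show ?case
      by blast
  qed auto
  then show ?thesis
    unfolding alg_smooth_def alg_differentiable_def mem_Collect_eq using D by metis
qed

section \<open>Symbols of operators\<close>

text \<open>The polynomial corresponding to \<open>diff_op n a\<close> under D \<mapsto> x. It is
  attached to the data \<open>n\<close> and \<open>a\<close> rather than to the operator.\<close>

definition symbol :: "nat \<Rightarrow> (nat \<Rightarrow> 'a) \<Rightarrow> 'a::comm_ring_1 poly"
  where "symbol n a = (\<Sum>i\<le>n. monom (a i) i)"

lemma coeff_symbol: "coeff (symbol n a) i = (if i \<le> n then a i else 0)"
  by (simp add: symbol_def coeff_sum)

text \<open>A derivative of order \<open>i + j\<close> of the k-th divided power has value 1 at 0 if
  \<open>i + j = k\<close> and value 0 otherwise, which leaves exactly the convolution of the
  coefficients.\<close>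

lemma diff_op_compose_monomial:
  fixes a b :: "nat \<Rightarrow> 'a::{real_normed_vector, real_algebra_1, comm_ring_1}"
  assumes mult: "bounded_bilinear ((*) :: 'a \<Rightarrow> 'a \<Rightarrow> 'a)"
  shows "diff_op n a (diff_op m b (exp_poly k (\<lambda>r. if r = k then 1 else 0))) 0 =
    coeff (symbol n a * symbol m b) k"
proof -
  let ?b = "\<lambda>r. \<Sum>j\<le>m. b j * (if r + j = k then 1 else 0)"
  have b: "?b r = (if r \<le> k then coeff (symbol m b) (k - r) else 0)" for r
  proof -
    have "?b r = (\<Sum>j\<le>m. if j = k - r then (if r \<le> k then b j else 0) else 0)"
      by (intro sum.cong) auto
    then show ?thesis
      by (simp add: coeff_symbol)
  qed
  have "diff_op n a (diff_op m b (exp_poly k (\<lambda>r. if r = k then 1 else 0))) 0 =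
      diff_op n a (exp_poly k ?b) 0"
    by (simp add: diff_op_exp_poly[OF mult])
  \<comment> \<open>By \<open>b\<close>, the sequence \<open>?b\<close> vanishes beyond
    \<open>k\<close>, as the second application of \<open>diff_op_exp_poly\<close> requires.\<close>
  also have "\<dots> = (\<Sum>i\<le>n. a i * ?b i)"
    by (subst diff_op_exp_poly[OF mult]) (simp_all add: b cong: if_cong)
  \<comment> \<open>The intersection mediates between the ranges: \<open>?b i\<close> is zero for
    \<open>i > k\<close>, and the coefficient of \<open>symbol n a\<close> is zero for
    \<open>i > n\<close>.\<close>
  also have "\<dots> = (\<Sum>i\<in>{..n} \<inter> {..k}. a i * coeff (symbol m b) (k - i))"
    unfolding b by (intro sum.mono_neutral_cong_right) auto
  also have "\<dots> = (\<Sum>i\<le>k. coeff (symbol n a) i * coeff (symbol m b) (k - i))"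
    by (intro sum.mono_neutral_cong_left) (auto simp: coeff_symbol)
  finally show ?thesis
    by (simp add: coeff_mult)
qed

section \<open>The two directions of the equivalence\<close>

lemma zd_diff_op_annihilator:
  fixes L :: "('a :: {real_normed_vector, real_algebra_1, comm_ring_1} \<Rightarrow> 'a) \<Rightarrow> ('a \<Rightarrow> 'a)"
  assumes mult: "bounded_bilinear ((*) :: 'a \<Rightarrow> 'a \<Rightarrow> 'a)"
    and L: "L \<in> zd diff_op_ring"
  shows "\<exists>c. c \<noteq> 0 \<and> (\<forall>f \<in> alg_smooth. L (\<lambda>z. c * f z) = (\<lambda>z. 0))"
proof (cases "L = \<zero>\<^bsub>diff_op_ring\<^esub>")
  case True
  then show ?thesis
    by (intro exI[of _ 1]) (simp add: diff_op_ring_def)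
next
  case False
  with L obtain n a m b where La: "L = diff_op n a"
    and S0: "diff_op m b \<noteq> \<zero>\<^bsub>diff_op_ring\<^esub>"
    and LS: "compose alg_smooth L (diff_op m b) = \<zero>\<^bsub>diff_op_ring\<^esub>"
    by (auto simp: zd_def diff_op_ring_def)
  have "symbol n a * symbol m b = 0"
  proof (rule poly_eqI)
    fix k
    let ?e = "exp_poly k (\<lambda>r. if r = k then 1 else 0) :: 'a \<Rightarrow> 'a"
    have "?e \<in> alg_smooth"
      using exp_poly_smooth[OF mult] by simp
    then have "L (diff_op m b ?e) 0 = 0"
      using fun_cong[OF LS, of ?e] by (simp add: compose_def diff_op_ring_def)
    then show "coeff (symbol n a * symbol m b) k = coeff 0 k"
      by (simp add: La diff_op_compose_monomial[OF mult])
  qed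
  \<comment> \<open>A zero symbol would make every coefficient up to order \<open>m\<close> vanish,
    and with them the operator.\<close>
  moreover have "symbol m b \<noteq> 0"
  proof
    assume "symbol m b = 0"
    then have "b j = 0" if "j \<le> m" for j
      using coeff_symbol[of m b j] that by simp
    then show False
      using S0 by (simp add: diff_op_def diff_op_ring_def)
  qed
  ultimately obtain c where c: "c \<noteq> 0" "\<And>i. coeff (symbol n a) i * c = 0"
    using mccoy by blast
  have ac: "a i * (c * x) = 0" if "i \<le> n" for i x
    using c(2)[of i] that by (simp add: coeff_symbol mult.assoc[symmetric])
  have "L (\<lambda>z. c * f z) = (\<lambda>z. 0)" if "f \<in> alg_smooth" for f
    using that mult
    by (simp add: La diff_op_def alg_smooth_cmult alg_deriv_funpow_cmult ac)
  with c(1) show ?thesis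
    by blast
qed

lemma annihilator_imp_zd_diff_op:
  fixes L :: "('a :: {real_normed_vector, real_algebra_1, comm_ring_1} \<Rightarrow> 'a) \<Rightarrow> ('a \<Rightarrow> 'a)"
  assumes L: "L \<in> carrier diff_op_ring"
    and c: "c \<noteq> 0" "\<And>f. f \<in> alg_smooth \<Longrightarrow> L (\<lambda>z. c * f z) = (\<lambda>z. 0)"
  shows "L \<in> zd diff_op_ring"
proof -
  \<comment> \<open>With order bound 0 only index 0 of the constant sequence is read, so this is
    multiplication by \<open>c\<close>.\<close>
  let ?S = "diff_op 0 (\<lambda>_. c)"
  have S: "?S f = (\<lambda>z. c * f z)" if "f \<in> alg_smooth" for f
    using that by (simp add: diff_op_def)
  have "?S (\<lambda>z. 1) 0 \<noteq> 0"
    using c(1) by (simp add: S const_smooth)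
  then have "?S \<noteq> \<zero>\<^bsub>diff_op_ring\<^esub>"
    by (auto simp: diff_op_ring_def const_smooth)
  \<comment> \<open>Both operators are restricted to \<open>alg_smooth\<close>, so it suffices to
    compare them on smooth functions.\<close>
  moreover have "L \<otimes>\<^bsub>diff_op_ring\<^esub> ?S = \<zero>\<^bsub>diff_op_ring\<^esub>"
    by (auto simp: diff_op_ring_def compose_def S c(2) intro!: restrict_ext)
  moreover have "?S \<in> carrier diff_op_ring"
    by (auto simp: diff_op_ring_def)
  ultimately show ?thesis
    using L by (auto simp: zd_def)
qed

theorem theorem6p3:
  fixes L :: "('a :: {real_normed_vector, real_algebra_1, comm_ring_1} \<Rightarrow> 'a) \<Rightarrow> ('a \<Rightarrow> 'a)"
  assumes "\<exists>B :: 'a set. finite B \<and> span B = UNIV"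
    and "L \<in> carrier diff_op_ring"
  shows "(\<exists>c :: 'a. c \<noteq> 0 \<and> (\<forall>f \<in> alg_smooth. ode_solution L (\<lambda>z. c * f z)))
           \<longleftrightarrow> L \<in> zd diff_op_ring"
proof -
  have mult: "bounded_bilinear ((*) :: 'a \<Rightarrow> 'a \<Rightarrow> 'a)"
    using assms(1) by (rule bounded_bilinear_mult_finite_dim)
  show ?thesis
    \<comment> \<open>A solution must itself be smooth; \<open>alg_smooth_cmult\<close> provides
      this for the functions \<open>c * f z\<close>.\<close>
    using annihilator_imp_zd_diff_op[OF assms(2)] zd_diff_op_annihilator[OF mult]
      alg_smooth_cmult[OF mult]
    unfolding ode_solution_def by metis
qed

end
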